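(* Let $\boldsymbol{Q}\in\mathbb{R}^{n\times n}$ be a positive definite factorizable matrix defined by $\{u_i\}_{i\in[n]}$ and $\{v_i\}_{i\in[n]}$, with associated matrices $\boldsymbol{\Lambda}_{i\to j}$, $1\le i<j\le n+1$, and let $$X_{\boldsymbol{Q}}:=\left\{(\boldsymbol{x},\boldsymbol{z},\tau)\in\mathbb{R}^n\times\{0,1\}^n\times\mathbb{R}_+:\ \tau\ge\boldsymbol{x}^\top\boldsymbol{Q}\boldsymbol{x},\ x_i(1-z_i)=0,\ i\in[n]\right\}.$$ Then $\mathrm{cl}\,\mathrm{conv}(X_{\boldsymbol{Q}})$ is the set of all $(\boldsymbol{x},\boldsymbol{z},\tau)\in\mathbb{R}^{2n+1}$ for which there exist $\boldsymbol{W}\in\mathbb{R}^{n\times n}$ and $\boldsymbol{w}=(w_{ij})_{0\le i<j\le n+1}\in\mathbb{R}_+^{(n+1)(n+2)/2}$ such that $$\begin{bmatrix}\boldsymbol{W}&\boldsymbol{x}\\ \boldsymbol{x}^\top&\tau\end{bmatrix}\succeq\boldsymbol{0},\qquad \boldsymbol{W}=\sum_{i=1}^n\sum_{j=i+1}^{n+1}\boldsymbol{\Lambda}_{i\to j}w_{ij},\qquad z_\ell=\sum_{i=0}^{\ell-1}w_{i\ell},\ \ \ell\in[n],$$ $$\sum_{i=0}^{\ell-1}w_{i\ell}-\sum_{j=\ell+1}^{n+1}w_{\ell j}=\begin{cases}-1&\text{if }\ell=0\\ 1&\text{if }\ell=n+1\\ 0&\text{otherwise}\end{cases}\qquad \e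ll\in\{0,\dots,n+1\}.$$
   Context: $[n]=\{1,\dots,n\}$; $\boldsymbol{e}_i$ is the $i$-th standard basis vector of $\mathbb{R}^n$; $\mathrm{cl}\,\mathrm{conv}$ denotes the closure of the convex hull. A symmetric matrix $\boldsymbol{Q}\in\mathbb{R}^{n\times n}$ is factorizable, defined by real sequences $\{u_i\}_{i\in[n]}$, $\{v_i\}_{i\in[n]}$, if $Q_{ij}=Q_{ji}=u_iv_j$ for $1\le i\le j\le n$. When $\boldsymbol{Q}$ is positive definite one has $u_iv_i>0$ for all $i$ and $u_iv_j(u_jv_i-u_iv_j)>0$ for all $i<j$, so the following matrices are well defined: $$\boldsymbol{\Lambda}_{i\to j}:=\frac{u_j}{u_i(u_jv_i-u_iv_j)}\left(\boldsymbol{e}_i-\frac{u_i}{u_j}\boldsymbol{e}_j\right)\left(\boldsymbol{e}_i-\frac{u_i}{u_j}\boldsymbol{e}_j\right)^\top,\ 1\le i<j\le n,\qquad \boldsymbol{\Lambda}_{i\to n+1}:=\frac{1}{u_iv_i}\boldsymbol{e}_i\boldsymbol{e}_i^\top,\ 1\le i\le n.$$ *)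

theory Defs
  imports "HOL-Analysis.Analysis"
begin

definition positive_semidefinite :: "real^'n^'n \<Rightarrow> bool" where
  "positive_semidefinite A \<longleftrightarrow> transpose A = A \<and> (\<forall>x. 0 \<le> x \<bullet> (A *v x))"

definition positive_definite :: "real^'n^'n \<Rightarrow> bool" where
  "positive_definite A \<longleftrightarrow> transpose A = A \<and> (\<forall>x. x \<noteq> 0 \<longrightarrow> 0 < x \<bullet> (A *v x))"

text \<open>
  The coordinates of a vector in \<open>real^'n\<close> are indexed by an arbitrary finite type. In what
  follows \<open>e :: nat \<Rightarrow> 'n\<close> is a numbering of these coordinates, that is, a bijection from
  \<open>{1..CARD('n)}\<close> to \<open>'n\<close>, so that coordinate \<open>i\<close> of \<open>x\<close> is \<open>x $ e i\<close> and the \<open>i\<close>-th standard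
  basis vector is \<open>axis (e i) 1\<close>.
\<close>

definition factorizable ::
    "(nat \<Rightarrow> 'n::finite) \<Rightarrow> real^'n^'n \<Rightarrow> (nat \<Rightarrow> real) \<Rightarrow> (nat \<Rightarrow> real) \<Rightarrow> bool" where
  "factorizable e Q u v \<longleftrightarrow>
     (\<forall>i j. 1 \<le> i \<and> i \<le> j \<and> j \<le> CARD('n) \<longrightarrow>
        Q $ e i $ e j = u i * v j \<and> Q $ e j $ e i = u i * v j)"

definition outer_square :: "real^'n \<Rightarrow> real^'n^'n" where
  "outer_square a = (columnvector a :: real^1^'n) ** rowvector a"

text \<open>Only meant for \<open>1 \<le> i < j \<le> CARD('n) + 1\<close>.\<close>

definition Lam ::
    "(nat \<Rightarrow> 'n::finite) \<Rightarrow> (nat \<Rightarrow> real) \<Rightarrow> (nat \<Rightarrow> real) \<Rightarrow> nat \<Rightarrow> nat \<Rightarrow> real^'n^'n" where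
  "Lam e u v i j =
     (if j = CARD('n) + 1
      then (1 / (u i * v i)) *\<^sub>R outer_square (axis (e i) 1)
      else (u j / (u i * (u j * v i - u i * v j))) *\<^sub>R
             outer_square (axis (e i) 1 - (u i / u j) *\<^sub>R axis (e j) 1))"

definition X_set :: "real^'n^'n \<Rightarrow> ((real^'n) \<times> (real^'n) \<times> real) set" where
  "X_set Q = {(x, z, \<tau>). (\<forall>i. z $ i \<in> {0, 1}) \<and> 0 \<le> \<tau> \<and>
                 x \<bullet> (Q *v x) \<le> \<tau> \<and> (\<forall>i. x $ i * (1 - z $ i) = 0)}"

text \<open>The block matrix with blocks \<open>W\<close>, \<open>x\<close> in the first row and \<open>x\<^sup>T\<close>, \<open>\<tau>\<close> in the second.\<close>

definition bordered :: "real^'n^'n \<Rightarrow> real^'n \<Rightarrow> real \<Rightarrow> real^('n + unit)^('n + unit)" where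
  "bordered W x \<tau> =
     (\<chi> r c. case r of
        Inl i \<Rightarrow> (case c of Inl j \<Rightarrow> W $ i $ j | Inr _ \<Rightarrow> x $ i)
      | Inr _ \<Rightarrow> (case c of Inl j \<Rightarrow> x $ j | Inr _ \<Rightarrow> \<tau>))"

end

(*
For S = {s_1 < ... < s_k} the principal submatrix of Q on S is again factorizable, so its inverse,
padded with zeros, is the sum of the rank-one matrices Lambda along the path
0 -> s_1 -> ... -> s_k -> n + 1 (edges out of 0 contributing 0). The pairs (W, z) admitted by the
flow constraints are exactly the convex hull of the pairs (P_S, 1_S), because unit flows on an
acyclic network are convex combinations of paths. If W = sum_S lambda_S P_S, the bordered matrix is
positive semidefinite iff x = W y and y^T W y <= tau for some y, and then
x = sum_S lambda_S P_S y splits (x, z, tau) into points of X, as P_S Q P_S = P_S. Hence the convex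
hull of X already equals the right-hand side, which is closed because (W, z) ranges over a compact set.
*)
theory Submission
  imports Defs
begin

subsection \<open>Unit flows and paths\<close>

text \<open>Source 0 and sink \<open>m\<close>; entries of \<open>w\<close> outside i < j \<le> m
  are unconstrained. The balance is spelled out as in the theorem, so that unfolding recovers its
  constraints.\<close>

definition unit_flow :: "nat \<Rightarrow> (nat \<Rightarrow> nat \<Rightarrow> real) \<Rightarrow> bool" where
  "unit_flow m w \<longleftrightarrow>
     (\<forall>i j. i < j \<and> j \<le> m \<longrightarrow> 0 \<le> w i j) \<and>
     (\<forall>l \<in> {0..m}. (\<Sum>i = 0..<l. w i l) - (\<Sum>j = l + 1..m. w l j) =
        (if l = 0 then - 1 else if l = m then 1 else 0))"

definition flow_sum ::
    "(nat \<Rightarrow> nat \<Rightarrow> 'a::real_vector) \<Rightarrow> nat \<Rightarrow> (nat \<Rightarrow> nat \<Rightarrow> real) \<Rightarrow> 'a" where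
  "flow_sum c m w = (\<Sum>i = 0..m. \<Sum>j = i + 1..m. w i j *\<^sub>R c i j)"

text \<open>The list holds the interior vertices of a path from \<open>i\<close> to the sink
  \<open>m\<close>, so \<open>[]\<close> is the single edge from \<open>i\<close> to
  \<open>m\<close>.\<close>

fun path_sum :: "(nat \<Rightarrow> nat \<Rightarrow> 'a::comm_monoid_add) \<Rightarrow> nat \<Rightarrow> nat \<Rightarrow> nat list \<Rightarrow> 'a" where
  "path_sum c m i [] = c i m"
| "path_sum c m i (j # js) = c i j + path_sum c m j js"

definition paths :: "nat \<Rightarrow> nat \<Rightarrow> nat list set" where
  "paths m i = {js. sorted_wrt (<) (i # js) \<and> set js \<subseteq> {..<m}}"

lemma Nil_in_paths [simp]: "[] \<in> paths m i"
  by (simp add: paths_def)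

lemma Cons_in_paths [simp]: "j # js \<in> paths m i \<longleftrightarrow> i < j \<and> j < m \<and> js \<in> paths m j"
  by (auto simp: paths_def)

lemma paths_bounds:
  assumes "js \<in> paths m i" "j \<in> set js"
  shows "i < j" "j < m"
  using assms by (auto simp: paths_def)

lemma finite_paths: "finite (paths m i)"
proof (rule finite_subset)
  show "paths m i \<subseteq> {js. set js \<subseteq> {..<m} \<and> distinct js}"
    by (auto simp: paths_def strict_sorted_iff)
  show "finite {js. set js \<subseteq> {..<m} \<and> distinct js}"
    by (rule finite_subset_distinct) simp
qed

lemma sum_upper_triangle_swap:
  "(\<Sum>i = 0..m. \<Sum>j = i + 1..m. f i j) = (\<Sum>j = 0..m. \<Sum>i = 0..<j. f i j)"
  for f :: "nat \<Rightarrow> nat \<Rightarrow> 'a::comm_monoid_add"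
proof (induction m)
  case (Suc m)
  have "(\<Sum>i = 0..m. \<Sum>j = i + 1..Suc m. f i j) =
      (\<Sum>i = 0..m. (\<Sum>j = i + 1..m. f i j) + f i (Suc m))"
    by (rule sum.cong) auto
  then show ?case
    using Suc by (simp add: sum.distrib atLeastLessThanSuc_atLeastAtMost)
qed simp

text \<open>Summation by parts: after exchanging the sums, each \<open>d l\<close> is multiplied by
  the net inflow at \<open>l\<close>, which vanishes except at source and sink.\<close>

lemma unit_flow_potential:
  fixes d :: "nat \<Rightarrow> real"
  assumes "unit_flow m w" "0 < m"
  shows "(\<Sum>i = 0..m. \<Sum>j = i + 1..m. w i j * (d j - d i)) = d m - d 0"
proof -
  have "(\<Sum>i = 0..m. \<Sum>j = i + 1..m. w i j * (d j - d i)) =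
      (\<Sum>i = 0..m. \<Sum>j = i + 1..m. w i j * d j) - (\<Sum>i = 0..m. \<Sum>j = i + 1..m. w i j * d i)"
    by (simp add: right_diff_distrib sum_subtractf)
  also have "\<dots> = (\<Sum>l = 0..m. d l * ((\<Sum>i = 0..<l. w i l) - (\<Sum>j = l + 1..m. w l j)))"
    unfolding sum_upper_triangle_swap[of "\<lambda>i j. w i j * d j"]
    by (simp add: right_diff_distrib sum_subtractf sum_distrib_left mult.commute)
  also have "\<dots> = (\<Sum>l = 0..m. (if l = 0 then - d 0 else 0) + (if l = m then d m else 0))"
    using assms by (intro sum.cong) (auto simp: unit_flow_def)
  also have "\<dots> = d m - d 0"
    by (simp add: sum.distrib)
  finally show ?thesis .
qed

text \<open>Shortest-path duality: a functional \<open>a\<close> separating the flow sum from the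
  hull gives edge costs under which the flow is cheaper than every path. A shortest-path potential,
  however, bounds the cost of any unit flow below by \<open>d 0\<close>, the cost of some
  path.\<close>

lemma flow_sum_in_paths_hull:
  fixes c :: "nat \<Rightarrow> nat \<Rightarrow> 'a::euclidean_space"
  assumes w: "unit_flow m w" and m: "0 < m"
  shows "flow_sum c m w \<in> convex hull (path_sum c m 0 ` paths m 0)" (is "?f \<in> ?K")
proof (rule ccontr)
  assume "?f \<notin> ?K"
  moreover have "closed ?K"
    by (intro compact_imp_closed finite_imp_compact_convex_hull finite_imageI finite_paths)
  ultimately obtain a b where ab: "a \<bullet> ?f < b" "\<forall>x\<in>?K. a \<bullet> x > b"
    using separating_hyperplane_closed_point[of ?K ?f] by auto
  \<comment> \<open>The potential of a vertex is the length of a shortest path from it to the sink.\<close>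
  define d where "d i = (if i < m then Min ((\<lambda>js. a \<bullet> path_sum c m i js) ` paths m i) else 0)" for i
  have d_le: "d i \<le> a \<bullet> path_sum c m i js" if "i < m" "js \<in> paths m i" for i js
    using that by (auto simp: d_def finite_paths)
  have d_ex: "\<exists>js\<in>paths m i. d i = a \<bullet> path_sum c m i js" if "i < m" for i
  proof -
    have "Min ((\<lambda>js. a \<bullet> path_sum c m i js) ` paths m i) \<in> (\<lambda>js. a \<bullet> path_sum c m i js) ` paths m i"
      using Nil_in_paths by (intro Min_in) (auto simp: finite_paths simp del: Nil_in_paths)
    then show ?thesis
      using that by (auto simp: d_def)
  qed
  \<comment> \<open>Dual feasibility: prefixing the edge from \<open>i\<close> to \<open>j\<close>
    to a shortest path from \<open>j\<close> gives a path from \<open>i\<close>. For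
    \<open>j = m\<close> the edge itself is the path, and \<open>d m = 0\<close>.\<close>
  have step: "- (a \<bullet> c i j) \<le> d j - d i" if "i < j" "j \<le> m" for i j
  proof (cases "j < m")
    case True
    then obtain js where "js \<in> paths m j" "d j = a \<bullet> path_sum c m j js"
      using d_ex by blast
    then show ?thesis
      using d_le[of i "j # js"] that True by (simp add: inner_add_right)
  next
    case False
    then show ?thesis
      using d_le[of i "[]"] that by (auto simp: d_def)
  qed
  have "- (a \<bullet> ?f) = (\<Sum>i = 0..m. \<Sum>j = i + 1..m. w i j * - (a \<bullet> c i j))"
    by (simp add: flow_sum_def inner_sum_right sum_negf)
  also have "\<dots> \<le> (\<Sum>i = 0..m. \<Sum>j = i + 1..m. w i j * (d j - d i))"
    using w step by (intro sum_mono mult_left_mono) (auto simp: unit_flow_def)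
  also have "\<dots> = - d 0"
    using unit_flow_potential[OF w m] by (simp add: d_def[of m])
  finally have "d 0 < b"
    using ab by simp
  moreover obtain js where "js \<in> paths m 0" "d 0 = a \<bullet> path_sum c m 0 js"
    using d_ex m by blast
  ultimately show False
    using ab(2) hull_inc[of "path_sum c m 0 js" "path_sum c m 0 ` paths m 0" convex] by force
qed

section \<open>Paths as unit flows\<close>

lemma flow_sum_add: "flow_sum c m (\<lambda>i j. v i j + w i j) = flow_sum c m v + flow_sum c m w"
  by (simp add: flow_sum_def scaleR_left_distrib sum.distrib)

lemma flow_sum_scale: "flow_sum c m (\<lambda>i j. r * w i j) = r *\<^sub>R flow_sum c m w"
  by (simp add: flow_sum_def scaleR_sum_right)

lemma flow_sum_edge:
  assumes "i < j" "j \<le> m"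
  shows "flow_sum c m (\<lambda>k l. of_bool (k = i \<and> l = j)) = c i j"
proof -
  have "(\<Sum>l = k + 1..m. of_bool (k = i \<and> l = j) *\<^sub>R c k l) = (if k = i then c i j else 0)" for k
    using assms by (cases "k = i") (auto simp: of_bool_def if_distrib[of "\<lambda>r. r *\<^sub>R _"] cong: if_cong)
  then show ?thesis
    using assms by (simp add: flow_sum_def)
qed

text \<open>Linear in \<open>w\<close> and not tied to a particular source, so flows can be
  assembled edge by edge.\<close>

definition net_inflow :: "nat \<Rightarrow> (nat \<Rightarrow> nat \<Rightarrow> real) \<Rightarrow> nat \<Rightarrow> real" where
  "net_inflow m w l = (\<Sum>i = 0..<l. w i l) - (\<Sum>j = l + 1..m. w l j)"

lemma net_inflow_add:
  "net_inflow m (\<lambda>i j. v i j + w i j) l = net_inflow m v l + net_inflow m w l"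
  by (simp add: net_inflow_def sum.distrib)

lemma net_inflow_scale: "net_inflow m (\<lambda>i j. r * w i j) l = r * net_inflow m w l"
  by (simp add: net_inflow_def sum_distrib_left right_diff_distrib)

lemma net_inflow_edge:
  assumes "i < j" "j \<le> m"
  shows "net_inflow m (\<lambda>k l. of_bool (k = i \<and> l = j)) l = of_bool (l = j) - of_bool (l = i)"
proof -
  have "(\<Sum>k = 0..<l. of_bool (k = i \<and> l = j)) = (of_bool (l = j) :: real)"
    using assms by (cases "l = j") (auto simp: of_bool_def)
  moreover have "(\<Sum>k = l + 1..m. of_bool (l = i \<and> k = j)) = (of_bool (l = i) :: real)"
    using assms by (cases "l = i") (auto simp: of_bool_def)
  ultimately show ?thesis
    by (simp add: net_inflow_def)
qed

lemma unit_flow_iff_net_inflow: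
  assumes "0 < m"
  shows "unit_flow m w \<longleftrightarrow> (\<forall>i j. i < j \<and> j \<le> m \<longrightarrow> 0 \<le> w i j) \<and>
     (\<forall>l\<le>m. net_inflow m w l = of_bool (l = m) - of_bool (l = 0))"
  using assms by (auto simp: unit_flow_def net_inflow_def)

text \<open>The witness is the indicator flow of the path. The source varies in the induction:
  adding the edge from \<open>i\<close> to \<open>j\<close> balances \<open>j\<close> and moves the
  source to \<open>i\<close>.\<close>

lemma path_sum_eq_flow_sum:
  assumes "i < m" "js \<in> paths m i"
  shows "\<exists>w. (\<forall>k l. 0 \<le> w k l) \<and>
     (\<forall>l\<le>m. net_inflow m w l = of_bool (l = m) - of_bool (l = i)) \<and>
     flow_sum c m w = path_sum c m i js"
  using assms
proof (induction js arbitrary: i)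
  case Nil
  then show ?case
    by (intro exI[of _ "\<lambda>k l. of_bool (k = i \<and> l = m)"]) (simp add: net_inflow_edge flow_sum_edge)
next
  case (Cons j js)
  then have "j < m" "js \<in> paths m j"
    by simp_all
  from Cons.IH[OF this] obtain w where "\<forall>k l. 0 \<le> w k l"
     "\<forall>l\<le>m. net_inflow m w l = of_bool (l = m) - of_bool (l = j)"
     "flow_sum c m w = path_sum c m j js"
    by blast
  with Cons.prems show ?case
    by (intro exI[of _ "\<lambda>k l. of_bool (k = i \<and> l = j) + w k l"])
      (simp add: net_inflow_edge flow_sum_edge net_inflow_add flow_sum_add)
qed

lemma convex_flow_sums:
  assumes "0 < m"
  shows "convex {flow_sum c m w | w. unit_flow m w}"
proof (rule convexI)
  fix x y and r s :: real
  assume rs: "0 \<le> r" "0 \<le> s" "r + s = 1"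
    and "x \<in> {flow_sum c m w | w. unit_flow m w}" "y \<in> {flow_sum c m w | w. unit_flow m w}"
  then obtain v w where "unit_flow m v" "unit_flow m w" "x = flow_sum c m v" "y = flow_sum c m w"
    by blast
  with rs have "unit_flow m (\<lambda>i j. r * v i j + s * w i j)"
    by (auto simp: unit_flow_iff_net_inflow[OF assms] net_inflow_add net_inflow_scale
        distrib_right[symmetric])
  moreover have "r *\<^sub>R x + s *\<^sub>R y = flow_sum c m (\<lambda>i j. r * v i j + s * w i j)"
    using \<open>x = _\<close> \<open>y = _\<close> by (simp add: flow_sum_add flow_sum_scale)
  ultimately show "r *\<^sub>R x + s *\<^sub>R y \<in> {flow_sum c m w | w. unit_flow m w}"
    by blast
qed

text \<open>The edge labels are kept arbitrary because W and z must later be represented by one and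
  the same flow.\<close>

lemma flow_sums_eq_paths_hull:
  fixes c :: "nat \<Rightarrow> nat \<Rightarrow> 'a::euclidean_space"
  assumes "0 < m"
  shows "{flow_sum c m w | w. unit_flow m w} = convex hull (path_sum c m 0 ` paths m 0)"
proof (intro equalityI hull_minimal)
  show "path_sum c m 0 ` paths m 0 \<subseteq> {flow_sum c m w | w. unit_flow m w}"
  proof (rule image_subsetI)
    fix js assume "js \<in> paths m 0"
    from path_sum_eq_flow_sum[OF assms this, of c] obtain w
      where "unit_flow m w" "flow_sum c m w = path_sum c m 0 js"
      by (auto simp: unit_flow_iff_net_inflow[OF assms])
    then show "path_sum c m 0 js \<in> {flow_sum c m w | w. unit_flow m w}"
      by (metis (mono_tags) mem_Collect_eq)
  qed
qed (use flow_sum_in_paths_hull assms in \<open>auto simp: convex_flow_sums\<close>)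

subsection \<open>Bordered positive semidefinite matrices\<close>

lemma outer_square_mult_vec: "outer_square a *v x = (a \<bullet> x) *\<^sub>R a" for a x :: "real^'n"
  unfolding outer_square_def matrix_vector_mul_assoc[symmetric]
  by (simp add: vec_eq_iff matrix_vector_mult_def columnvector_def rowvector_def inner_vec_def mult.commute)

lemma transpose_outer_square: "transpose (outer_square a) = outer_square a"
  by (simp add: vec_eq_iff outer_square_def matrix_matrix_mult_def transpose_def columnvector_def
      rowvector_def mult.commute)

lemma scaleR_matrix_mult_vec: "(r *\<^sub>R A) *v x = r *\<^sub>R (A *v x)" for A :: "real^'n^'m"
  by (simp add: vec_eq_iff matrix_vector_mult_def sum_distrib_left mult.assoc)

lemma transpose_scaleR_real: "transpose (r *\<^sub>R A) = r *\<^sub>R transpose A" for A :: "real^'n^'m"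
  by (simp add: vec_eq_iff transpose_def)

lemma transpose_plus: "transpose (A + B) = transpose A + transpose B" for A :: "real^'n^'m"
  by (simp add: vec_eq_iff transpose_def)

lemma positive_semidefinite_zero: "positive_semidefinite (0 :: real^'n^'n)"
  by (simp add: positive_semidefinite_def transpose_def vec_eq_iff)

lemma positive_semidefinite_outer_square: "positive_semidefinite (outer_square a)"
  by (simp add: positive_semidefinite_def transpose_outer_square outer_square_mult_vec inner_commute)

lemma positive_semidefinite_add:
  "positive_semidefinite A \<Longrightarrow> positive_semidefinite B \<Longrightarrow> positive_semidefinite (A + B)"
  by (simp add: positive_semidefinite_def transpose_plus matrix_vector_mult_add_rdistrib inner_add_right)

lemma positive_semidefinite_scale:
  "positive_semidefinite A \<Longrightarrow> 0 \<le> r \<Longrightarrow> positive_semidefinite (r *\<^sub>R A)"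
  by (simp add: positive_semidefinite_def transpose_scaleR_real scaleR_matrix_mult_vec)

lemma inner_symmetric_matrix:
  "transpose A = A \<Longrightarrow> x \<bullet> (A *v y) = (A *v x) \<bullet> y" for A :: "real^'n^'n"
  by (metis dot_lmul_matrix transpose_matrix_vector)

text \<open>Split \<open>x\<close> into \<open>y\<close> in the range of \<open>A\<close> and
  \<open>k\<close> orthogonal to it. Symmetry puts \<open>k\<close> in the kernel, so the hypothesis
  makes \<open>k\<close> orthogonal to \<open>x\<close>, hence to itself.\<close>

lemma symmetric_range_solvable:
  fixes A :: "real^'n^'n"
  assumes "transpose A = A" and "\<And>k. A *v k = 0 \<Longrightarrow> k \<bullet> x = 0"
  shows "\<exists>y. x = A *v y"
proof -
  obtain y k where yk: "y \<in> span (range ((*v) A))" "\<And>b. b \<in> span (range ((*v) A)) \<Longrightarrow> orthogonal k b" "x = y + k"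
    using orthogonal_subspace_decomp_exists[of "range ((*v) A)" x] by metis
  have range: "span (range ((*v) A)) = range ((*v) A)"
    by (simp add: linear_subspace_image matrix_vector_mul_linear)
  have "(A *v k) \<bullet> a = 0" for a
    using yk(2)[of "A *v a"] inner_symmetric_matrix[OF assms(1), of k a]
    by (simp add: orthogonal_def span_base)
  then have "A *v k = 0"
    by (metis inner_eq_zero_iff)
  then have "k \<bullet> (y + k) = 0"
    using assms(2) yk(3) by simp
  moreover have "k \<bullet> y = 0"
    using yk(1,2) by (simp add: orthogonal_def)
  ultimately have "k = 0"
    by (simp add: inner_add_right)
  with yk range show ?thesis
    by auto
qed

lemma sum_UNIV_plus: "(\<Sum>i\<in>UNIV. f i) = (\<Sum>i\<in>UNIV. f (Inl i)) + (\<Sum>i\<in>UNIV. f (Inr i))"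
  for f :: "'a::finite + 'b::finite \<Rightarrow> 'c::comm_monoid_add"
  by (simp add: UNIV_Plus_UNIV[symmetric] sum.Plus del: UNIV_Plus_UNIV)

lemma all_bordered_vec: "(\<forall>b :: real^('n::finite + unit). P b) \<longleftrightarrow>
    (\<forall>a t. P (\<chi> i. case i of Inl j \<Rightarrow> a $ j | Inr _ \<Rightarrow> t))"
proof (intro iffI allI)
  fix b :: "real^('n + unit)"
  assume *: "\<forall>a t. P (\<chi> i. case i of Inl j \<Rightarrow> (a :: real^'n) $ j | Inr _ \<Rightarrow> t)"
  have "b = (\<chi> i. case i of Inl j \<Rightarrow> (\<chi> k. b $ Inl k) $ j | Inr _ \<Rightarrow> b $ Inr ())"
    by (auto simp: vec_eq_iff split: sum.split)
  with * show "P b"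
    by metis
qed blast

text \<open>Evaluates the quadratic form at the block vector (a, t). For fixed \<open>a\<close> and
  \<open>t\<close> the condition is linear in W, \<open>x\<close> and \<open>\<tau>\<close>, which
  later gives closedness.\<close>

lemma positive_semidefinite_bordered:
  "positive_semidefinite (bordered W x \<tau>) \<longleftrightarrow>
     transpose W = W \<and> (\<forall>a t. 0 \<le> a \<bullet> (W *v a) + 2 * t * (a \<bullet> x) + t\<^sup>2 * \<tau>)"
proof -
  have "transpose (bordered W x \<tau>) = bordered W x \<tau> \<longleftrightarrow> transpose W = W"
    by (auto simp: vec_eq_iff transpose_def bordered_def split_sum_all)
  moreover have "b \<bullet> (bordered W x \<tau> *v b) = a \<bullet> (W *v a) + 2 * t * (a \<bullet> x) + t\<^sup>2 * \<tau>"
    if "b = (\<chi> i. case i of Inl j \<Rightarrow> a $ j | Inr _ \<Rightarrow> t)" for a t b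
    unfolding that
    by (simp add: inner_vec_def matrix_vector_mult_def bordered_def sum_UNIV_plus UNIV_unit
        distrib_left sum.distrib sum_distrib_left power2_eq_square mult_ac)
  ultimately show ?thesis
    by (simp add: positive_semidefinite_def all_bordered_vec)
qed

text \<open>A Schur complement criterion for possibly singular W: a solution \<open>y\<close> of
  \<open>x = W *v y\<close> replaces the inverse applied to \<open>x\<close>.\<close>

lemma positive_semidefinite_bordered_iff:
  fixes W :: "real^'n^'n"
  assumes W: "positive_semidefinite W"
  shows "positive_semidefinite (bordered W x \<tau>) \<longleftrightarrow> (\<exists>y. x = W *v y \<and> y \<bullet> (W *v y) \<le> \<tau>)"
proof
  assume "positive_semidefinite (bordered W x \<tau>)"
  then have q: "0 \<le> a \<bullet> (W *v a) + 2 * t * (a \<bullet> x) + t\<^sup>2 * \<tau>" for a t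
    by (simp add: positive_semidefinite_bordered)
  have "k \<bullet> x = 0" if "W *v k = 0" for k
  proof (rule ccontr)
    assume "k \<bullet> x \<noteq> 0"
    \<comment> \<open>With \<open>t = 1\<close>, this multiple of the kernel vector \<open>k\<close>
      makes the form equal to -1.\<close>
    with q[of "(- (\<tau> + 1) / (2 * (k \<bullet> x))) *\<^sub>R k" 1] that show False
      by (simp add: matrix_vector_mult_scaleR field_simps)
  qed
  then obtain y where y: "x = W *v y"
    using symmetric_range_solvable W by (metis positive_semidefinite_def)
  \<comment> \<open>At (-y, 1) the form equals \<open>\<tau> - y \<bullet> (W *v y)\<close>.\<close>
  have "y \<bullet> (W *v y) \<le> \<tau>"
    using q[of "- y" 1] y by (simp add: linear_neg[OF matrix_vector_mul_linear])
  with y show "\<exists>y. x = W *v y \<and> y \<bullet> (W *v y) \<le> \<tau>"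
    by blast
next
  assume "\<exists>y. x = W *v y \<and> y \<bullet> (W *v y) \<le> \<tau>"
  then obtain y where y: "x = W *v y" "y \<bullet> (W *v y) \<le> \<tau>"
    by blast
  have "0 \<le> a \<bullet> (W *v a) + 2 * t * (a \<bullet> x) + t\<^sup>2 * \<tau>" for a t
  proof -
    \<comment> \<open>The target form with the square completed.\<close>
    have "0 \<le> (a + t *\<^sub>R y) \<bullet> (W *v (a + t *\<^sub>R y)) + t\<^sup>2 * (\<tau> - y \<bullet> (W *v y))"
      using W y(2) by (simp add: positive_semidefinite_def)
    also have "\<dots> = a \<bullet> (W *v a) + 2 * t * (a \<bullet> x) + t\<^sup>2 * \<tau>"
      using inner_symmetric_matrix[of W a y] W unfolding positive_semidefinite_def y(1)
      by (simp add: matrix_vector_right_distrib matrix_vector_mult_scaleR inner_add_left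
          inner_add_right algebra_simps power2_eq_square inner_commute)
    finally show ?thesis .
  qed
  with W show "positive_semidefinite (bordered W x \<tau>)"
    unfolding positive_semidefinite_bordered by (simp add: positive_semidefinite_def)
qed

lemma closed_positive_semidefinite_bordered:
  "closed {(W :: real^'n^'n, x, \<tau>). positive_semidefinite (bordered W x \<tau>)}"
proof -
  have "{(W :: real^'n^'n, x, \<tau>). positive_semidefinite (bordered W x \<tau>)} =
    {p. transpose (fst p) = fst p} \<inter>
    (\<Inter>a t. {p. 0 \<le> a \<bullet> (fst p *v a) + 2 * t * (a \<bullet> fst (snd p)) + t\<^sup>2 * snd (snd p)})"
    by (auto simp: positive_semidefinite_bordered)
  moreover have "closed {p :: (real^'n^'n) \<times> (real^'n) \<times> real. transpose (fst p) = fst p}"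
    unfolding transpose_def by (intro closed_Collect_eq continuous_intros)
  moreover have "closed {p :: (real^'n^'n) \<times> (real^'n) \<times> real.
      0 \<le> a \<bullet> (fst p *v a) + 2 * t * (a \<bullet> fst (snd p)) + t\<^sup>2 * snd (snd p)}" for a t
    unfolding matrix_vector_mult_def
    by (intro closed_Collect_le continuous_intros)
  ultimately show ?thesis
    by (simp add: closed_Int closed_INT)
qed

lemma positive_semidefinite_bordered_convex:
  assumes "positive_semidefinite (bordered W x \<tau>)" "positive_semidefinite (bordered W' x' \<tau>')"
    "0 \<le> r" "0 \<le> s"
  shows "positive_semidefinite
    (bordered (r *\<^sub>R W + s *\<^sub>R W') (r *\<^sub>R x + s *\<^sub>R x') (r * \<tau> + s * \<tau>'))"
proof -
  have "bordered (r *\<^sub>R W + s *\<^sub>R W') (r *\<^sub>R x + s *\<^sub>R x') (r * \<tau> + s * \<tau>') =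
      r *\<^sub>R bordered W x \<tau> + s *\<^sub>R bordered W' x' \<tau>'"
    by (auto simp: vec_eq_iff bordered_def split: sum.split)
  with assms show ?thesis
    by (simp add: positive_semidefinite_add positive_semidefinite_scale)
qed

subsection \<open>Path matrices of a factorizable matrix\<close>

lemma path_sum_Pair:
  "path_sum (\<lambda>i j. (f i j, g i j)) m i js = (path_sum f m i js, path_sum g m i js)"
  by (induction js arbitrary: i) auto

locale pd_factorizable =
  fixes Q :: "real^'n^'n" and u v :: "nat \<Rightarrow> real" and e :: "nat \<Rightarrow> 'n" and n :: nat
  assumes n_def: "n = CARD('n)"
    and bij: "bij_betw e {1..n} UNIV"
    and pd: "positive_definite Q"
    and fac: "factorizable e Q u v"
begin

abbreviation b :: "nat \<Rightarrow> real^'n" where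
  "b i \<equiv> axis (e i) 1"

lemma sum_UNIV_e: "(\<Sum>k\<in>UNIV. f k) = (\<Sum>m = 1..n. f (e m))"
  by (rule sum.reindex_bij_betw[OF bij, symmetric])

lemma all_e: "(\<forall>k. P k) \<longleftrightarrow> (\<forall>l\<in>{1..n}. P (e l))"
proof -
  have "(\<forall>k. P k) \<longleftrightarrow> (\<forall>k\<in>e ` {1..n}. P k)"
    unfolding bij_betw_imp_surj_on[OF bij] by simp
  then show ?thesis
    by simp
qed

lemma e_eq_iff: "i \<in> {1..n} \<Longrightarrow> j \<in> {1..n} \<Longrightarrow> e i = e j \<longleftrightarrow> i = j"
  by (rule inj_on_eq_iff[OF bij_betw_imp_inj_on[OF bij]])

lemma b_nth: "i \<in> {1..n} \<Longrightarrow> j \<in> {1..n} \<Longrightarrow> b i $ e j = of_bool (i = j)"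
  by (auto simp: axis_def e_eq_iff)

lemma Q_nth:
  assumes "i \<in> {1..n}" "j \<in> {1..n}"
  shows "Q $ e i $ e j = (if j \<le> i then u j * v i else u i * v j)"
  using fac assms by (auto simp: factorizable_def n_def)

lemma Q_mult_nth:
  assumes "i \<in> {1..n}"
  shows "(Q *v x) $ e i = (\<Sum>m = 1..n. (if m \<le> i then u m * v i else u i * v m) * x $ e m)"
  unfolding matrix_vector_mult_def vec_lambda_beta sum_UNIV_e
  by (rule sum.cong) (use assms in \<open>auto simp: Q_nth\<close>)

lemma Q_mult_b: "i \<in> {1..n} \<Longrightarrow> j \<in> {1..n} \<Longrightarrow> (Q *v b i) $ e j = Q $ e j $ e i"
  by (simp add: matrix_vector_mult_basis column_def)

section \<open>Sign conditions from positive definiteness\<close>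

lemma uv_pos: "i \<in> {1..n} \<Longrightarrow> 0 < u i * v i"
proof -
  assume i: "i \<in> {1..n}"
  have "0 < b i \<bullet> (Q *v b i)"
    using pd by (simp add: positive_definite_def axis_eq_0_iff)
  with i show ?thesis
    by (simp add: inner_axis' Q_mult_b Q_nth)
qed

lemma u_nonzero: "i \<in> {1..n} \<Longrightarrow> u i \<noteq> 0"
  using uv_pos[of i] by auto

lemma minor_pos:
  assumes "1 \<le> i" "i < j" "j \<le> n"
  shows "0 < u i * u j * (u j * v i - u i * v j)"
proof -
  have ij: "i \<in> {1..n}" "j \<in> {1..n}" "i \<noteq> j"
    using assms by auto
  \<comment> \<open>This is \<open>u j\<close> times the vector whose outer square appears in
    \<open>Lam e u v i j\<close>.\<close>
  define x where "x = u j *\<^sub>R b i - u i *\<^sub>R b j"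
  have "x $ e i \<noteq> 0"
    using ij by (simp add: x_def b_nth u_nonzero)
  then have "0 < x \<bullet> (Q *v x)"
    using pd by (metis positive_definite_def zero_index)
  also have "x \<bullet> (Q *v x) = u i * u j * (u j * v i - u i * v j)"
    using ij assms
    by (simp add: x_def matrix_vector_mult_diff_distrib matrix_vector_mult_scaleR inner_diff_left
        inner_diff_right inner_axis' Q_mult_b Q_nth algebra_simps)
  finally show ?thesis .
qed

text \<open>
  If \<open>x\<close> vanishes strictly between \<open>i\<close> and \<open>j\<close>, then \<open>Lam e u v i j *v (Q *v x)\<close> depends only on the
  following prefix sum: rows \<open>i\<close> and \<open>j\<close> of \<open>Q\<close> are proportional in the columns from \<open>j\<close> on. Along a
  path these contributions telescope.
\<close>

definition prefix_sum :: "real^'n \<Rightarrow> nat \<Rightarrow> real" where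
  "prefix_sum x i = (\<Sum>m = 1..i. u m * x $ e m)"

lemma Lam_mult_Q:
  assumes ij: "1 \<le> i" "i < j" "j \<le> n" and gap: "\<And>m. i < m \<Longrightarrow> m < j \<Longrightarrow> x $ e m = 0"
  shows "Lam e u v i j *v (Q *v x) = prefix_sum x i *\<^sub>R ((1 / u i) *\<^sub>R b i - (1 / u j) *\<^sub>R b j)"
proof -
  have mem: "i \<in> {1..n}" "j \<in> {1..n}"
    using ij by auto
  let ?D = "u j * v i - u i * v j"
  have D: "?D \<noteq> 0"
    using minor_pos[OF ij] by auto
  have "(b i - (u i / u j) *\<^sub>R b j) \<bullet> (Q *v x) = (Q *v x) $ e i - u i / u j * (Q *v x) $ e j"
    by (simp add: inner_diff_left inner_axis')
  also have "\<dots> = (\<Sum>m = 1..n. if m \<in> {1..i} then ?D / u j * (u m * x $ e m) else 0)"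
    unfolding Q_mult_nth[OF mem(1)] Q_mult_nth[OF mem(2)] sum_distrib_left sum_subtractf[symmetric]
  proof (rule sum.cong)
    fix m assume "m \<in> {1..n}"
    \<comment> \<open>Up to column \<open>i\<close> the two rows combine to a multiple of
      \<open>?D\<close>; strictly between \<open>i\<close> and \<open>j\<close> the entry of
      \<open>x\<close> vanishes; from column \<open>j\<close> on the rows cancel.\<close>
    consider "m \<le> i" | "i < m" "m < j" | "m = j" | "j < m"
      by linarith
    then show "(if m \<le> i then u m * v i else u i * v m) * x $ e m -
        u i / u j * ((if m \<le> j then u m * v j else u j * v m) * x $ e m) =
        (if m \<in> {1..i} then ?D / u j * (u m * x $ e m) else 0)"
      by cases (use ij gap \<open>m \<in> {1..n}\<close> u_nonzero[OF mem(2)] in \<open>auto simp: field_simps\<close>)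
  qed simp
  also have "\<dots> = (\<Sum>m\<in>{1..n} \<inter> {1..i}. ?D / u j * (u m * x $ e m))"
    by (rule sum.inter_restrict[symmetric]) simp
  also have "{1..n} \<inter> {1..i} = {1..i}"
    using ij by auto
  finally have eq: "(b i - (u i / u j) *\<^sub>R b j) \<bullet> (Q *v x) = ?D / u j * prefix_sum x i"
    by (simp add: prefix_sum_def sum_distrib_left)
  have "j \<noteq> CARD('n) + 1"
    using ij n_def by simp
  then show ?thesis
    using D u_nonzero[OF mem(1)] u_nonzero[OF mem(2)]
    by (simp add: Lam_def scaleR_matrix_mult_vec outer_square_mult_vec eq scaleR_diff_right)
qed

text \<open>The edge into the sink: as \<open>x\<close> vanishes after \<open>i\<close>, row
  \<open>i\<close> of \<open>Q\<close> yields \<open>v i\<close> times the prefix sum, and no later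
  vertex receives a compensating term.\<close>

lemma Lam_last_mult_Q:
  assumes i: "i \<in> {1..n}" and gap: "\<And>m. i < m \<Longrightarrow> m \<le> n \<Longrightarrow> x $ e m = 0"
  shows "Lam e u v i (n + 1) *v (Q *v x) = (prefix_sum x i / u i) *\<^sub>R b i"
proof -
  have "(Q *v x) $ e i = (\<Sum>m = 1..n. if m \<in> {1..i} then v i * (u m * x $ e m) else 0)"
    unfolding Q_mult_nth[OF i] by (rule sum.cong) (use gap in auto)
  also have "\<dots> = (\<Sum>m\<in>{1..n} \<inter> {1..i}. v i * (u m * x $ e m))"
    by (rule sum.inter_restrict[symmetric]) simp
  also have "{1..n} \<inter> {1..i} = {1..i}"
    using i by auto
  finally have "(Q *v x) $ e i = v i * prefix_sum x i"
    by (simp add: prefix_sum_def sum_distrib_left)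
  moreover have "v i \<noteq> 0"
    using uv_pos[OF i] by auto
  ultimately show ?thesis
    by (simp add: Lam_def n_def scaleR_matrix_mult_vec outer_square_mult_vec inner_axis')
qed

lemma positive_semidefinite_Lam:
  assumes "1 \<le> i" "i < j" "j \<le> n + 1"
  shows "positive_semidefinite (Lam e u v i j)"
proof (cases "j = n + 1")
  case True
  then show ?thesis
    using uv_pos[of i] assms
    by (auto simp: Lam_def n_def intro!: positive_semidefinite_scale positive_semidefinite_outer_square)
next
  case False
  with assms have j: "j \<le> n" "u i \<noteq> 0" "u j \<noteq> 0"
    using u_nonzero by auto
  \<comment> \<open>\<open>minor_pos\<close> gives the sign only of the product containing
    \<open>u j\<close>, so the fraction is expanded by \<open>u j\<close>.\<close>
  have "u j / (u i * (u j * v i - u i * v j)) = (u j)\<^sup>2 / (u i * u j * (u j * v i - u i * v j))"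
    using j by (simp add: power2_eq_square)
  also have "\<dots> \<ge> 0"
    using minor_pos[OF assms(1,2) j(1)] by simp
  finally show ?thesis
    using False
    by (auto simp: Lam_def n_def intro!: positive_semidefinite_scale positive_semidefinite_outer_square)
qed

section \<open>Matrices and indicator vectors of paths\<close>

definition edge :: "nat \<Rightarrow> nat \<Rightarrow> real^'n^'n" where
  "edge i j = (if i = 0 then 0 else Lam e u v i j)"

text \<open>A vertex is charged to the edges entering it; the sink counts as zero.\<close>

definition vert :: "nat \<Rightarrow> real^'n" where
  "vert j = (if j \<le> n then b j else 0)"

text \<open>For a path from 0 with interior vertex set S, these are the padded inverse P_S and the
  indicator vector of S.\<close>

abbreviation "path_mat \<equiv> path_sum edge (Suc n)"
abbreviation "path_vec \<equiv> path_sum (\<lambda>_. vert) (Suc n)"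

lemma path_vec_eq: "js \<in> paths (Suc n) i \<Longrightarrow> path_vec i js = (\<Sum>j\<in>set js. b j)"
proof (induction js arbitrary: i)
  case (Cons j js)
  then have "j \<notin> set js"
    using paths_bounds(1)[of js "Suc n" j j] by auto
  with Cons show ?case
    by (simp add: vert_def)
qed (simp add: vert_def)

lemma path_vec_nth:
  assumes "js \<in> paths (Suc n) 0" "l \<in> {1..n}"
  shows "path_vec 0 js $ e l = of_bool (l \<in> set js)"
proof -
  have "set js \<subseteq> {1..n}"
    using paths_bounds[OF assms(1)] by force
  then have "path_vec 0 js $ e l = (\<Sum>j\<in>set js. of_bool (j = l))"
    unfolding path_vec_eq[OF assms(1)] sum_component
    by (intro sum.cong) (use assms(2) in \<open>auto simp: b_nth\<close>)
  then show ?thesis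
    by (simp add: of_bool_def)
qed

lemma positive_semidefinite_path_mat:
  "js \<in> paths (Suc n) i \<Longrightarrow> i \<le> n \<Longrightarrow> positive_semidefinite (path_mat i js)"
proof (induction js arbitrary: i)
  case Nil
  then show ?case
    using positive_semidefinite_Lam[of i "n + 1"] by (auto simp: edge_def positive_semidefinite_zero)
next
  case (Cons j js)
  then have "positive_semidefinite (edge i j)"
    using positive_semidefinite_Lam[of i j] by (auto simp: edge_def positive_semidefinite_zero)
  moreover have "positive_semidefinite (path_mat j js)"
    using Cons by simp
  ultimately show ?case
    by (simp add: positive_semidefinite_add)
qed

lemma edge_mult_nth:
  assumes "i < j" "j \<le> n + 1" "l \<in> {1..n}" "l \<noteq> i" "l \<noteq> j"
  shows "(edge i j *v y) $ e l = 0"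
proof (cases "i = 0")
  case False
  with assms have "i \<in> {1..n}" by auto
  moreover have "j \<in> {1..n}" if "j \<noteq> n + 1"
    using that assms by auto
  ultimately show ?thesis
    using assms False n_def
    by (auto simp: edge_def Lam_def scaleR_matrix_mult_vec outer_square_mult_vec b_nth)
qed (simp add: edge_def)

text \<open>Each edge matrix touches only the endpoints of its edge. For \<open>i = 0\<close> this
  makes P_S y supported on S, as complementarity of x and z demands.\<close>

lemma path_mat_mult_nth:
  assumes "js \<in> paths (Suc n) i" "i \<le> n" "l \<in> {1..n}" "l \<notin> set (i # js)"
  shows "(path_mat i js *v y) $ e l = 0"
  using assms
proof (induction js arbitrary: i)
  case Nil
  then have "(edge i (n + 1) *v y) $ e l = 0"
    by (intro edge_mult_nth) auto
  then show ?case
    by simp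
next
  case (Cons j js)
  then have "(path_mat j js *v y) $ e l = 0"
    by (intro Cons.IH) auto
  moreover have "(edge i j *v y) $ e l = 0"
    using Cons.prems by (intro edge_mult_nth) auto
  ultimately show ?case
    by (simp add: matrix_vector_mult_add_rdistrib)
qed

text \<open>Telescoping: at \<open>b j\<close> the edge from \<open>i\<close> subtracts
  \<open>prefix_sum x i / u j\<close>, while the rest of the path contributes
  \<open>prefix_sum x j / u j\<close>. As \<open>x\<close> vanishes between \<open>i\<close> and
  \<open>j\<close>, the difference is \<open>x $ e j\<close>.\<close>

lemma path_mat_mult_Q_aux:
  assumes "js \<in> paths (Suc n) i" "i \<in> {1..n}"
    and "\<And>m. i < m \<Longrightarrow> m \<le> n \<Longrightarrow> m \<notin> set js \<Longrightarrow> x $ e m = 0"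
  shows "path_mat i js *v (Q *v x) = (prefix_sum x i / u i) *\<^sub>R b i + (\<Sum>j\<in>set js. x $ e j *\<^sub>R b j)"
  using assms
proof (induction js arbitrary: i)
  case Nil
  then show ?case
    using Lam_last_mult_Q[of i x] by (simp add: edge_def)
next
  case (Cons j js)
  then have j: "i < j" "j \<in> {1..n}" "js \<in> paths (Suc n) j" "\<And>m. m \<in> set js \<Longrightarrow> j < m"
    using paths_bounds(1)[of js "Suc n" j] by auto
  have gap: "x $ e m = 0" if "i < m" "m < j" for m
    using Cons.prems(3)[of m] j that by force
  have IH: "path_mat j js *v (Q *v x) = (prefix_sum x j / u j) *\<^sub>R b j + (\<Sum>j\<in>set js. x $ e j *\<^sub>R b j)"
    using Cons.prems(3) j by (intro Cons.IH) auto
  have "prefix_sum x j = (\<Sum>m\<in>{1..i} \<union> {j}. u m * x $ e m)"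
    unfolding prefix_sum_def by (rule sum.mono_neutral_right) (use j Cons.prems(2) gap in auto)
  also have "\<dots> = prefix_sum x i + u j * x $ e j"
    using j by (simp add: prefix_sum_def)
  finally have prefix_j: "prefix_sum x j / u j = prefix_sum x i / u j + x $ e j"
    using u_nonzero[OF j(2)] by (simp add: add_divide_distrib)
  have "edge i j *v (Q *v x) = prefix_sum x i *\<^sub>R ((1 / u i) *\<^sub>R b i - (1 / u j) *\<^sub>R b j)"
    using Lam_mult_Q[of i j x] gap j Cons.prems(2) by (simp add: edge_def)
  moreover have "j \<notin> set js"
    using j(4) by auto
  ultimately show ?case
    by (simp add: matrix_vector_mult_add_rdistrib IH prefix_j scaleR_diff_right scaleR_add_left)
qed

text \<open>The edge out of 0 contributes nothing, so the telescoped formula applies from the first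
  vertex of S. This identifies P_S as the inverse of \<open>Q\<close> on S without computing
  one.\<close>

lemma path_mat_mult_Q:
  assumes js: "js \<in> paths (Suc n) 0"
    and x: "\<And>m. m \<in> {1..n} \<Longrightarrow> m \<notin> set js \<Longrightarrow> x $ e m = 0"
  shows "path_mat 0 js *v (Q *v x) = x"
proof -
  have "path_mat 0 js *v (Q *v x) = (\<Sum>j\<in>set js. x $ e j *\<^sub>R b j)"
  proof (cases js)
    case Nil
    then show ?thesis
      by (simp add: edge_def)
  next
    case (Cons j js')
    then have j: "j \<in> {1..n}" "js' \<in> paths (Suc n) j" "\<And>m. m \<in> set js' \<Longrightarrow> j < m"
      using js paths_bounds(1)[of js' "Suc n" j] by auto
    \<comment> \<open>Below the first vertex \<open>x\<close> vanishes, so the prefix sum at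
      \<open>j\<close> is a single term and the boundary coefficient is
      \<open>x $ e j\<close>.\<close>
    have "x $ e m = 0" if "m \<in> {1..n}" "m < j" for m
      using x[of m] Cons j that by force
    moreover have "{1..j} = {1..<j} \<union> {j}"
      using j by auto
    ultimately have "prefix_sum x j / u j = x $ e j"
      using j u_nonzero[OF j(1)] unfolding prefix_sum_def by (simp add: sum.union_disjoint)
    moreover have "j \<notin> set js'"
      using j(3) by auto
    ultimately show ?thesis
      using path_mat_mult_Q_aux[of js' j x] j x Cons
      by (simp add: edge_def)
  qed
  also have "\<dots> = x"
  proof -
    have sub: "set js \<subseteq> {1..n}"
      using paths_bounds[OF js] by force
    have "(\<Sum>j\<in>set js. x $ e j *\<^sub>R b j) $ e l = x $ e l" if l: "l \<in> {1..n}" for l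
    proof -
      have "(\<Sum>j\<in>set js. x $ e j *\<^sub>R b j) $ e l = (\<Sum>j\<in>set js. if j = l then x $ e l else 0)"
        unfolding sum_component by (intro sum.cong) (use sub l in \<open>auto simp: b_nth\<close>)
      then show ?thesis
        using x[OF l] by simp
    qed
    then show ?thesis
      by (simp add: vec_eq_iff all_e)
  qed
  finally show ?thesis .
qed

section \<open>The lifted formulation\<close>

definition path_hull :: "((real^'n^'n) \<times> (real^'n)) set" where
  "path_hull = convex hull ((\<lambda>js. (path_mat 0 js, path_vec 0 js)) ` paths (Suc n) 0)"

definition lifted_set :: "((real^'n) \<times> (real^'n) \<times> real) set" where
  "lifted_set = {(x, z, \<tau>). \<exists>W. (W, z) \<in> path_hull \<and> positive_semidefinite (bordered W x \<tau>)}"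

lemma path_hull_eq_flow_sums: "path_hull = {flow_sum (\<lambda>i j. (edge i j, vert j)) (n + 1) w | w. unit_flow (n + 1) w}"
  using flow_sums_eq_paths_hull[of "n + 1" "\<lambda>i j. (edge i j, vert j)"]
  by (simp add: path_hull_def path_sum_Pair)

lemma flow_sum_edge_vert:
  "flow_sum (\<lambda>i j. (edge i j, vert j)) (n + 1) w =
     (\<Sum>i = 1..n. \<Sum>j = i + 1..n + 1. w i j *\<^sub>R Lam e u v i j,
      \<Sum>l = 1..n. (\<Sum>i = 0..<l. w i l) *\<^sub>R b l)"
proof (rule prod_eqI)
  have "fst (flow_sum (\<lambda>i j. (edge i j, vert j)) (n + 1) w) =
      (\<Sum>i = 0..n + 1. \<Sum>j = i + 1..n + 1. w i j *\<^sub>R edge i j)"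
    by (simp add: flow_sum_def fst_sum)
  also have "\<dots> = (\<Sum>i = 1..n. \<Sum>j = i + 1..n + 1. w i j *\<^sub>R edge i j)"
    \<comment> \<open>Edges out of the source carry the zero matrix, and no edge leaves the
      sink.\<close>
    by (rule sum.mono_neutral_right) (auto simp: edge_def Suc_le_eq not_le)
  also have "\<dots> = (\<Sum>i = 1..n. \<Sum>j = i + 1..n + 1. w i j *\<^sub>R Lam e u v i j)"
    by (intro sum.cong) (auto simp: edge_def)
  finally show "fst (flow_sum (\<lambda>i j. (edge i j, vert j)) (n + 1) w) =
      fst (\<Sum>i = 1..n. \<Sum>j = i + 1..n + 1. w i j *\<^sub>R Lam e u v i j,
        \<Sum>l = 1..n. (\<Sum>i = 0..<l. w i l) *\<^sub>R b l)"
    by simp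
  have "snd (flow_sum (\<lambda>i j. (edge i j, vert j)) (n + 1) w) =
      (\<Sum>i = 0..n + 1. \<Sum>j = i + 1..n + 1. w i j *\<^sub>R vert j)"
    by (simp add: flow_sum_def snd_sum)
  also have "\<dots> = (\<Sum>l = 0..n + 1. (\<Sum>i = 0..<l. w i l) *\<^sub>R vert l)"
    unfolding sum_upper_triangle_swap by (simp add: scaleR_sum_left)
  also have "\<dots> = (\<Sum>l = 1..n. (\<Sum>i = 0..<l. w i l) *\<^sub>R vert l)"
    \<comment> \<open>The term at 0 has an empty sum as coefficient, and the sink has label
      zero.\<close>
    by (rule sum.mono_neutral_right) (auto simp: vert_def Suc_le_eq not_le)
  also have "\<dots> = (\<Sum>l = 1..n. (\<Sum>i = 0..<l. w i l) *\<^sub>R b l)"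
    by (intro sum.cong) (auto simp: vert_def)
  finally show "snd (flow_sum (\<lambda>i j. (edge i j, vert j)) (n + 1) w) =
      snd (\<Sum>i = 1..n. \<Sum>j = i + 1..n + 1. w i j *\<^sub>R Lam e u v i j,
        \<Sum>l = 1..n. (\<Sum>i = 0..<l. w i l) *\<^sub>R b l)"
    by simp
qed

lemma eq_sum_b_iff: "z = (\<Sum>l = 1..n. f l *\<^sub>R b l) \<longleftrightarrow> (\<forall>l\<in>{1..n}. z $ e l = f l)"
proof -
  have "(\<Sum>m = 1..n. f m *\<^sub>R b m) $ e l = f l" if "l \<in> {1..n}" for l
  proof -
    have "(\<Sum>m = 1..n. f m *\<^sub>R b m) $ e l = (\<Sum>m = 1..n. if m = l then f l else 0)"
      unfolding sum_component by (intro sum.cong) (use that in \<open>auto simp: b_nth\<close>)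
    then show ?thesis
      using that by simp
  qed
  then show ?thesis
    by (simp add: vec_eq_iff all_e)
qed

lemma mem_path_hull_iff:
  "(W, z) \<in> path_hull \<longleftrightarrow> (\<exists>w. unit_flow (n + 1) w \<and>
     W = (\<Sum>i = 1..n. \<Sum>j = i + 1..n + 1. w i j *\<^sub>R Lam e u v i j) \<and>
     (\<forall>l \<in> {1..n}. z $ e l = (\<Sum>i = 0..<l. w i l)))"
  unfolding path_hull_eq_flow_sums flow_sum_edge_vert eq_sum_b_iff[symmetric] by blast

lemma positive_semidefinite_path_hull:
  assumes "(W, z) \<in> path_hull"
  shows "positive_semidefinite W"
proof -
  have "path_hull \<subseteq> {p. positive_semidefinite (fst p)}"
    unfolding path_hull_def
  proof (rule hull_minimal)
    show "convex {p :: (real^'n^'n) \<times> (real^'n). positive_semidefinite (fst p)}"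
      by (auto intro!: convexI positive_semidefinite_add positive_semidefinite_scale)
  qed (auto simp: positive_semidefinite_path_mat)
  with assms show ?thesis
    by auto
qed

text \<open>Projection along a compact factor preserves closedness. The factor is
  \<open>path_hull\<close>; the set projected requires matching \<open>z\<close> and a positive
  semidefinite bordered matrix.\<close>

lemma closed_lifted_set: "closed lifted_set"
proof -
  have eq: "lifted_set = {q. \<exists>p. p \<in> path_hull \<and> (p, q) \<in>
      {(p, q). snd p = fst (snd q)} \<inter>
      (\<lambda>(p, q). (fst p, fst q, snd (snd q))) -` {(W, x, \<tau>). positive_semidefinite (bordered W x \<tau>)}}"
    by (rule set_eqI) (auto simp: lifted_set_def)
  show ?thesis
    unfolding eq
  proof (rule closed_compact_projection)
    show "compact path_hull"
      unfolding path_hull_def by (intro finite_imp_compact_convex_hull finite_imageI finite_paths)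
    show "closed ({(p :: (real^'n^'n) \<times> (real^'n), q :: (real^'n) \<times> (real^'n) \<times> real). snd p = fst (snd q)} \<inter>
      (\<lambda>(p, q). (fst p, fst q, snd (snd q))) -` {(W, x, \<tau>). positive_semidefinite (bordered W x \<tau>)})"
      unfolding case_prod_unfold
      by (intro closed_Int closed_vimage closed_Collect_eq continuous_intros
          closed_positive_semidefinite_bordered[unfolded case_prod_unfold])
  qed
qed

lemma convex_lifted_set: "convex lifted_set"
proof (rule convexI)
  fix p q and r s :: real
  assume rs: "0 \<le> r" "0 \<le> s" "r + s = 1" and "p \<in> lifted_set" "q \<in> lifted_set"
  then obtain x z \<tau> W x' z' \<tau>' W' where p: "p = (x, z, \<tau>)" "(W, z) \<in> path_hull"
      "positive_semidefinite (bordered W x \<tau>)"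
    and q: "q = (x', z', \<tau>')" "(W', z') \<in> path_hull" "positive_semidefinite (bordered W' x' \<tau>')"
    unfolding lifted_set_def by blast
  have "convex path_hull"
    by (simp add: path_hull_def)
  from convexD[OF this p(2) q(2) rs]
  have "(r *\<^sub>R W + s *\<^sub>R W', r *\<^sub>R z + s *\<^sub>R z') \<in> path_hull"
    by simp
  then show "r *\<^sub>R p + s *\<^sub>R q \<in> lifted_set"
    using positive_semidefinite_bordered_convex[OF p(3) q(3) rs(1,2)] by (auto simp: lifted_set_def p(1) q(1))
qed

text \<open>For \<open>z\<close> the indicator of S, take the path through S and
  \<open>y = Q *v x\<close>. Then P_S y = x as \<open>x\<close> is supported on S, and y . P_S y =
  \<open>x \<bullet> (Q *v x)\<close>, which is at most \<open>\<tau>\<close>.\<close>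

lemma X_subset_lifted_set: "X_set Q \<subseteq> lifted_set"
proof
  fix p assume "p \<in> X_set Q"
  then obtain x z \<tau> where p: "p = (x, z, \<tau>)" and z: "\<And>k. z $ k \<in> {0, 1}"
    and \<tau>: "x \<bullet> (Q *v x) \<le> \<tau>" and xz: "\<And>k. x $ k * (1 - z $ k) = 0"
    unfolding X_set_def by blast
  define js where "js = sorted_list_of_set {l \<in> {1..n}. z $ e l = 1}"
  have set_js: "set js = {l \<in> {1..n}. z $ e l = 1}"
    by (simp add: js_def)
  have "sorted_wrt (<) js"
    by (simp add: js_def)
  then have js: "js \<in> paths (Suc n) 0"
    using set_js by (auto simp: paths_def)
  have "path_vec 0 js $ e l = z $ e l" if "l \<in> {1..n}" for l
    using z[of "e l"] that by (auto simp: path_vec_nth[OF js that] set_js)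
  then have "path_vec 0 js = z"
    by (simp add: vec_eq_iff all_e)
  then have "(path_mat 0 js, z) \<in> path_hull"
    using js unfolding path_hull_def by (intro hull_inc) auto
  moreover have "path_mat 0 js *v (Q *v x) = x"
    using xz z by (intro path_mat_mult_Q js) (auto simp: set_js)
  then have "positive_semidefinite (bordered (path_mat 0 js) x \<tau>)"
    using \<tau> js
    by (subst positive_semidefinite_bordered_iff)
      (auto simp: positive_semidefinite_path_mat inner_commute intro!: exI[of _ "Q *v x"])
  ultimately show "p \<in> lifted_set"
    by (auto simp: lifted_set_def p)
qed

text \<open>By P_S Q P_S = P_S, the quadratic form of \<open>Q\<close> at P_S y is y . P_S y;
  \<open>r\<close> is the slack.\<close>

lemma path_point_in_X:
  assumes js: "js \<in> paths (Suc n) 0" and "0 \<le> r"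
  shows "(path_mat 0 js *v y, path_vec 0 js, y \<bullet> (path_mat 0 js *v y) + r) \<in> X_set Q"
proof -
  let ?P = "path_mat 0 js"
  have P: "positive_semidefinite ?P"
    using js by (simp add: positive_semidefinite_path_mat)
  have supp: "(?P *v y) $ e m = 0" if "m \<in> {1..n}" "m \<notin> set js" for m
    using path_mat_mult_nth[OF js, of m y] that by simp
  have "y \<bullet> (?P *v y) = y \<bullet> (?P *v (Q *v (?P *v y)))"
    using path_mat_mult_Q[OF js supp] by simp
  also have "\<dots> = (?P *v y) \<bullet> (Q *v (?P *v y))"
    using P by (intro inner_symmetric_matrix) (simp add: positive_semidefinite_def)
  finally have "(?P *v y) \<bullet> (Q *v (?P *v y)) \<le> y \<bullet> (?P *v y) + r"
    using \<open>0 \<le> r\<close> by simp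
  then show ?thesis
    using P \<open>0 \<le> r\<close> supp by (auto simp: X_set_def all_e path_vec_nth[OF js] positive_semidefinite_def)
qed

text \<open>With \<open>y\<close> fixed, \<open>?g\<close> is affine in the pair (W, z) and sends
  the path pairs into X. The pairs sent into the hull of X therefore form a convex set containing
  all of \<open>path_hull\<close>.\<close>

lemma lifted_set_subset_hull: "lifted_set \<subseteq> convex hull (X_set Q)"
proof
  fix p assume "p \<in> lifted_set"
  then obtain x z \<tau> W where p: "p = (x, z, \<tau>)" and path_hull: "(W, z) \<in> path_hull"
    and "positive_semidefinite (bordered W x \<tau>)"
    unfolding lifted_set_def by blast
  then obtain y where y: "x = W *v y" "y \<bullet> (W *v y) \<le> \<tau>"
    by (auto simp: positive_semidefinite_bordered_iff positive_semidefinite_path_hull)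
  \<comment> \<open>A common slack, chosen so that \<open>?g (W, z)\<close> is exactly
    \<open>p\<close>.\<close>
  define r where "r = \<tau> - y \<bullet> (W *v y)"
  let ?g = "\<lambda>p :: (real^'n^'n) \<times> (real^'n). (fst p *v y, snd p, y \<bullet> (fst p *v y) + r)"
  have "path_hull \<subseteq> {p. ?g p \<in> convex hull (X_set Q)}"
    unfolding path_hull_def
  proof (rule hull_minimal)
    show "(\<lambda>js. (path_mat 0 js, path_vec 0 js)) ` paths (Suc n) 0 \<subseteq> {p. ?g p \<in> convex hull X_set Q}"
      using y(2) by (auto intro!: hull_inc path_point_in_X simp: r_def)
    show "convex {p. ?g p \<in> convex hull X_set Q}"
    proof (rule convexI)
      fix p q and s t :: real
      assume st: "0 \<le> s" "0 \<le> t" "s + t = 1"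
        and "p \<in> {p. ?g p \<in> convex hull X_set Q}" "q \<in> {p. ?g p \<in> convex hull X_set Q}"
      then have "s *\<^sub>R ?g p + t *\<^sub>R ?g q \<in> convex hull X_set Q"
        by (intro convexD[OF convex_convex_hull]) auto
      \<comment> \<open>The constant \<open>r\<close> survives because the weights sum to 1.\<close>
      moreover have sr: "s * r + t * r = r"
        using st(3) by (simp add: distrib_right[symmetric])
      have "s *\<^sub>R ?g p + t *\<^sub>R ?g q = ?g (s *\<^sub>R p + t *\<^sub>R q)"
        using sr by (simp add: matrix_vector_mult_add_rdistrib scaleR_matrix_mult_vec inner_add_right
            algebra_simps)
      ultimately show "s *\<^sub>R p + t *\<^sub>R q \<in> {p. ?g p \<in> convex hull X_set Q}"
        by (metis (mono_tags, lifting) mem_Collect_eq)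
    qed
  qed
  with path_hull y show "p \<in> convex hull (X_set Q)"
    by (auto simp: p r_def)
qed

lemma closure_hull_X: "closure (convex hull (X_set Q)) = lifted_set"
proof -
  have "convex hull (X_set Q) = lifted_set"
    by (intro equalityI lifted_set_subset_hull hull_minimal X_subset_lifted_set convex_lifted_set)
  then show ?thesis
    by (simp add: closed_lifted_set)
qed

end

theorem theorem6:
  fixes Q :: "real^'n^'n" and u v :: "nat \<Rightarrow> real" and e :: "nat \<Rightarrow> 'n" and n :: nat
  assumes "n = CARD('n)"
    and "bij_betw e {1..n} UNIV"
    and "positive_definite Q"
    and "factorizable e Q u v"
  shows "closure (convex hull (X_set Q)) =
    {(x, z, \<tau>). \<exists>(W :: real^'n^'n) (w :: nat \<Rightarrow> nat \<Rightarrow> real).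
       (\<forall>i j. i < j \<and> j \<le> n + 1 \<longrightarrow> 0 \<le> w i j) \<and>
       positive_semidefinite (bordered W x \<tau>) \<and>
       W = (\<Sum>i = 1..n. \<Sum>j = i + 1..n + 1. w i j *\<^sub>R Lam e u v i j) \<and>
       (\<forall>l \<in> {1..n}. z $ e l = (\<Sum>i = 0..<l. w i l)) \<and>
       (\<forall>l \<in> {0..n + 1}.
          (\<Sum>i = 0..<l. w i l) - (\<Sum>j = l + 1..n + 1. w l j) =
          (if l = 0 then - 1 else if l = n + 1 then 1 else 0))}"
proof -
  interpret pd_factorizable Q u v e n
    using assms by unfold_locales
  show ?thesis
    unfolding closure_hull_X lifted_set_def mem_path_hull_iff unit_flow_def
    by (intro Collect_cong prod.case_cong refl) blast
qed

end
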